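(* Let $X$ be a complex Banach space and $T\in\mathcal{B}(X)$. Then the following statements are equivalent: (i) There exist an operator $S_1\in\mathcal{B}(X)$ and an integer $j\ge 0$ such that $TS_1T=S_1T^2$, $S_1^2T=S_1$, $S_1T^{j+1}=T^j$. (ii) There exists a projection $P\in\mathcal{B}(X)$ such that $TP=PT$, $T+P$ is left invertible and $TP$ is nilpotent (i.e. $(TP)^j=0$ for some integer $j\ge 1$). (iii) $j:=\mathrm{asc}(T)<\infty$, and the subspaces $\mathcal{N}(T^j)$ and $\mathcal{R}(T^{j+1})$ are topologically complemented in $X$. (iv) There exist an integer $j\ge 0$ and a closed subspace $M$ such that $X=M\oplus\mathcal{N}(T^j)$, $T|_M$ is left invertible and $T|_{\mathcal{N}(T^j)}$ is nilpotent, where $M$ and $\mathcal{N}(T^j)$ reduce $T$. (v) There exist closed subspaces $M,N$ reducing $T$, so that $T=T|_M\oplus T|_N$, where $T|_M$ is left invertible and $T|_N$ is nilpotent. (vi) There exists an integer $j\ge 0$ such that $\mathcal{N}(T^j)$ is topologically complemented in $X$, $\mathcal{R}(T^j)$ is closed, and the operator $T_j:\mathcal{R}(T^j)\to\mathcal{R}(T^j)$ induced by $T$ is left invertible.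
   Context: $\mathcal{B}(X)$ is the algebra of bounded linear operators on $X$; $\mathcal{N}(T)$ and $\mathcal{R}(T)$ are the null space and range of $T$; $T^0=I$. A projection is an idempotent in $\mathcal{B}(X)$. An operator $A\in\mathcal{B}(Y)$ is left invertible if there is $B\in\mathcal{B}(Y)$ with $BA=I$. The ascent $\mathrm{asc}(T)$ is the smallest integer $p\ge 0$ with $\mathcal{N}(T^p)=\mathcal{N}(T^{p+1})$ ($\infty$ if none exists). Closed subspaces $M,N$ of $X$ reduce $T$ if $X=M\oplus N$ and both are invariant under $T$; then $T|_M\in\mathcal{B}(M)$, $T|_N\in\mathcal{B}(N)$ are the restrictions. A subspace is topologically complemented if it is closed and has a closed complement. *)

theory Defs
  imports "HOL-Analysis.Analysis" "HOL-Library.Extended_Nat"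
begin

text \<open>The distribution has no complex normed spaces; a complex Banach space is a real Banach space
  with a compatible multiplication by complex scalars for which the norm is homogeneous.\<close>

class complex_banach = banach +
  fixes scaleC :: "complex \<Rightarrow> 'a \<Rightarrow> 'a"  (infixr \<open>*\<^sub>C\<close> 75)
  assumes scaleC_add_right: "a *\<^sub>C (x + y) = a *\<^sub>C x + a *\<^sub>C y"
    and scaleC_add_left: "(a + b) *\<^sub>C x = a *\<^sub>C x + b *\<^sub>C x"
    and scaleC_scaleC: "a *\<^sub>C (b *\<^sub>C x) = (a * b) *\<^sub>C x"
    and scaleC_one: "1 *\<^sub>C x = x"
    and scaleC_of_real: "complex_of_real r *\<^sub>C x = r *\<^sub>R x"
    and norm_scaleC: "norm (a *\<^sub>C x) = cmod a * norm x"

instantiation complex :: complex_banach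
begin

definition scaleC_complex :: "complex \<Rightarrow> complex \<Rightarrow> complex"
  where "scaleC_complex a x = a * x"

instance
  by standard (simp_all add: scaleC_complex_def algebra_simps norm_mult scaleR_conv_of_real)

end

global_interpretation complex_vector:
  vector_space "scaleC :: complex \<Rightarrow> 'a \<Rightarrow> 'a::complex_banach"
  by unfold_locales (simp_all add: scaleC_add_right scaleC_add_left scaleC_scaleC scaleC_one)

abbreviation csubspace :: "'a::complex_banach set \<Rightarrow> bool"
  where "csubspace \<equiv> complex_vector.subspace"

definition closed_csubspace :: "'a::complex_banach set \<Rightarrow> bool"
  where "closed_csubspace M \<longleftrightarrow> csubspace M \<and> closed M"

definition bounded_clinear :: "('a::complex_banach \<Rightarrow> 'a) \<Rightarrow> bool"
  where "bounded_clinear f \<longleftrightarrow> bounded_linear f \<and> (\<forall>c x. f (c *\<^sub>C x) = c *\<^sub>C f x)"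

text \<open>An element of \<open>B(Y)\<close>, for a closed subspace \<open>Y\<close> of the ambient space, is represented by a
  function on the whole type of which only the values on \<open>Y\<close> matter. Thus the restriction of
  \<open>T\<close> to an invariant \<open>Y\<close> is represented by \<open>T\<close> itself.\<close>

definition bounded_clinear_on :: "'a::complex_banach set \<Rightarrow> ('a \<Rightarrow> 'a) \<Rightarrow> bool"
  where "bounded_clinear_on Y f \<longleftrightarrow>
    f ` Y \<subseteq> Y \<and>
    (\<forall>x\<in>Y. \<forall>y\<in>Y. f (x + y) = f x + f y) \<and>
    (\<forall>c. \<forall>x\<in>Y. f (c *\<^sub>C x) = c *\<^sub>C f x) \<and>
    (\<exists>K. \<forall>x\<in>Y. norm (f x) \<le> K * norm x)"

lemma bounded_clinear_on_UNIV: "bounded_clinear_on UNIV f \<longleftrightarrow> bounded_clinear f"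
proof
  assume f: "bounded_clinear_on UNIV f"
  then obtain K where "\<And>x. norm (f x) \<le> K * norm x"
    by (auto simp: bounded_clinear_on_def)
  then have "bounded_linear f"
    using f by (intro bounded_linear_intro[where K = K])
      (auto simp: bounded_clinear_on_def mult.commute simp flip: scaleC_of_real)
  then show "bounded_clinear f"
    using f by (auto simp: bounded_clinear_on_def bounded_clinear_def)
next
  assume "bounded_clinear f"
  then show "bounded_clinear_on UNIV f"
    unfolding bounded_clinear_def bounded_clinear_on_def
    by (auto simp: linear_simps mult.commute dest: bounded_linear.bounded)
      (metis bounded_linear.bounded mult.commute)
qed

definition left_invertible_on :: "'a::complex_banach set \<Rightarrow> ('a \<Rightarrow> 'a) \<Rightarrow> bool"
  where "left_invertible_on Y A \<longleftrightarrow>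
    bounded_clinear_on Y A \<and> (\<exists>B. bounded_clinear_on Y B \<and> (\<forall>x\<in>Y. B (A x) = x))"

definition nilpotent_on :: "'a::complex_banach set \<Rightarrow> ('a \<Rightarrow> 'a) \<Rightarrow> bool"
  where "nilpotent_on Y A \<longleftrightarrow>
    bounded_clinear_on Y A \<and> (\<exists>j\<ge>1. \<forall>x\<in>Y. (A ^^ j) x = 0)"

definition projection :: "('a::complex_banach \<Rightarrow> 'a) \<Rightarrow> bool"
  where "projection P \<longleftrightarrow> bounded_clinear P \<and> P \<circ> P = P"

definition null_space :: "('a::complex_banach \<Rightarrow> 'a) \<Rightarrow> 'a set"
  where "null_space T = {x. T x = 0}"

text \<open>The infimum of the empty set of extended naturals is \<open>\<infinity>\<close>.\<close>

definition asc :: "('a::complex_banach \<Rightarrow> 'a) \<Rightarrow> enat"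
  where "asc T = Inf {enat p | p. null_space (T ^^ p) = null_space (T ^^ (p + 1))}"

definition is_direct_sum :: "'a::complex_banach set \<Rightarrow> 'a set \<Rightarrow> bool"
  where "is_direct_sum M N \<longleftrightarrow> M \<inter> N = {0} \<and> {m + n | m n. m \<in> M \<and> n \<in> N} = UNIV"

definition top_complemented :: "'a::complex_banach set \<Rightarrow> bool"
  where "top_complemented M \<longleftrightarrow>
    closed_csubspace M \<and> (\<exists>N. closed_csubspace N \<and> is_direct_sum M N)"

definition reduce :: "'a::complex_banach set \<Rightarrow> 'a set \<Rightarrow> ('a \<Rightarrow> 'a) \<Rightarrow> bool"
  where "reduce M N T \<longleftrightarrow>
    closed_csubspace M \<and> closed_csubspace N \<and> is_direct_sum M N \<and> T ` M \<subseteq> M \<and> T ` N \<subseteq> N"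

text \<open>The following are equivalent.\<close>

definition tfae :: "bool list \<Rightarrow> bool"
  where "tfae Ps \<longleftrightarrow> (\<forall>P\<in>set Ps. \<forall>Q\<in>set Ps. P \<longleftrightarrow> Q)"

end

(*
  Condition (i) says that P = S T is a projection commuting with T that fixes the range of T^j;
  its range and null space give the decomposition in (iv), I - P is the projection in (ii), and
  T^k S^k projects onto the range of T^k for k >= j.

  Conversely, (iii) and (vi) yield a bounded W such that W T is a projection with null space
  N(T^j), although in general W T does not commute with T. Commuting projections with this null
  space correspond to sections of T^j intertwining T with its restriction to R(T^j). Correcting
  an arbitrary section amounts to solving a fixed point equation in N(T^j), where T is nilpotent,
  so iteration stops after j steps. Boundedness of all operators constructed from direct sums
  comes from the closed graph theorem.
*)

theory Submission
  imports Defs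
begin

section \<open>The closed graph theorem\<close>

lemma closed_graph_theorem:
  fixes f :: "'a::banach \<Rightarrow> 'b::banach"
  assumes "linear f"
    and closed_graph: "\<And>X x y. X \<longlonglongrightarrow> x \<Longrightarrow> (\<lambda>n. f (X n)) \<longlonglongrightarrow> y \<Longrightarrow> f x = y"
  shows "bounded_linear f"
proof -
  interpret linear f by fact
  define V where "V n = closure {x. norm (f x) \<le> real n}" for n
  have "\<exists>n. interior (V n) \<noteq> {}"
  proof (rule ccontr)
    assume "\<nexists>n. interior (V n) \<noteq> {}"
    then have "euclidean interior_of (\<Union> (range V)) = {}"
      by (intro Baire_category_alt disjI1 completely_metrizable_space_euclidean)
        (auto simp: V_def)
    moreover have "\<Union> (range V) = UNIV"
      using real_arch_simple closure_subset by (fastforce simp: V_def)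
    ultimately show False
      by simp
  qed
  then obtain n a where "a \<in> interior (V n)"
    by blast
  then obtain r where r: "r > 0" "ball a r \<subseteq> V n"
    using mem_interior by blast
  \<comment> \<open>subtract approximants of \<open>a\<close> from approximants of \<open>a + z\<close>\<close>
  have near: "\<exists>w. norm (f w) \<le> 2 * real n \<and> norm (z - w) < e" if "norm z < r" "e > 0" for z e
  proof -
    have "a + z \<in> V n" "a \<in> V n"
      using that r by (auto simp: subset_iff dist_norm)
    then obtain x y where "norm (f x) \<le> n" "dist x (a + z) < e/2" "norm (f y) \<le> n" "dist y a < e/2"
      using \<open>e > 0\<close> unfolding V_def closure_approachable
      by (metis (no_types, lifting) half_gt_zero mem_Collect_eq)
    then show ?thesis
      using norm_triangle_ineq4[of "f x" "f y"] norm_triangle_ineq4[of "a + z - x" "a - y"]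
      by (intro exI[of _ "x - y"])
        (auto simp: diff dist_norm norm_minus_commute algebra_simps)
  qed
  define C where "C = 4 * real n / r"
  have "\<exists>w. norm (f w) \<le> C * norm z \<and> norm (z - w) \<le> norm z / 2" for z
  proof (cases "z = 0")
    case False
    define c where "c = r / (2 * norm z)"
    have "c > 0" "norm (c *\<^sub>R z) < r"
      using False r by (auto simp: c_def)
    then obtain w where w: "norm (f w) \<le> 2 * real n" "norm (c *\<^sub>R z - w) < c * norm z / 2"
      using near[of "c *\<^sub>R z" "c * norm z / 2"] False by auto
    have "z - w /\<^sub>R c = (c *\<^sub>R z - w) /\<^sub>R c"
      using \<open>c > 0\<close> by (simp add: algebra_simps)
    then have "norm (z - w /\<^sub>R c) = norm (c *\<^sub>R z - w) / c"
      using \<open>c > 0\<close> by (simp add: divide_inverse_commute)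
    also have "\<dots> \<le> norm z / 2"
      using w(2) \<open>c > 0\<close> by (simp add: field_simps)
    finally have "norm (z - w /\<^sub>R c) \<le> norm z / 2" .
    moreover have "norm (f (w /\<^sub>R c)) \<le> C * norm z"
      using w(1) \<open>c > 0\<close> r False by (simp add: scale C_def c_def field_simps)
    ultimately show ?thesis
      by blast
  qed (auto intro!: exI[of _ 0])
  then obtain g where g: "\<And>z. norm (f (g z)) \<le> C * norm z" "\<And>z. norm (z - g z) \<le> norm z / 2"
    by metis
  have "C \<ge> 0"
    using r by (simp add: C_def)
  \<comment> \<open>successive approximation writes \<open>x\<close> as a series \<open>\<Sum>k. g (u k)\<close> whose image under \<open>f\<close> converges
    absolutely\<close>
  have "norm (f x) \<le> norm x * (2 * C)" for x
  proof -
    define u where "u k = ((\<lambda>z. z - g z) ^^ k) x" for k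
    have u_bound: "norm (u k) \<le> norm x * (1/2) ^ k" for k
    proof (induction k)
      case (Suc k)
      then show ?case
        using g(2)[of "u k"] by (simp add: u_def)
    qed (simp add: u_def)
    have "(\<lambda>k. norm x * (1/2) ^ k) \<longlonglongrightarrow> norm x * 0"
      by (intro tendsto_intros) auto
    then have "u \<longlonglongrightarrow> 0"
      by (intro Lim_null_comparison[of u "\<lambda>k. norm x * (1/2) ^ k"]) (simp_all add: u_bound)
    moreover have partial: "(\<Sum>i<k. g (u i)) = x - u k" for k
      by (induction k) (auto simp: u_def)
    ultimately have lim: "(\<lambda>k. \<Sum>i<k. g (u i)) \<longlonglongrightarrow> x"
      using tendsto_diff[of "\<lambda>_. x" x sequentially u 0] by simp
    have bound: "norm (f (g (u k))) \<le> C * norm x * (1/2) ^ k" for k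
      using g(1)[of "u k"] mult_left_mono[OF u_bound[of k] \<open>C \<ge> 0\<close>] by (simp add: mult.assoc)
    have geo: "(\<lambda>k. C * norm x * (1/2) ^ k) sums (C * norm x * 2)"
      using sums_mult[OF geometric_sums[of "1/2 :: real"], of "C * norm x"] by simp
    have summ: "summable (\<lambda>k. norm (f (g (u k))))"
      by (rule summable_comparison_test'[OF sums_summable[OF geo]]) (simp add: bound)
    have "(\<lambda>k. f (\<Sum>i<k. g (u i))) \<longlonglongrightarrow> (\<Sum>k. f (g (u k)))"
      using summable_LIMSEQ[OF summable_norm_cancel[OF summ]] by (simp add: sum)
    then have "f x = (\<Sum>k. f (g (u k)))"
      by (rule closed_graph[OF lim])
    also have "norm \<dots> \<le> (\<Sum>k. norm (f (g (u k))))"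
      by (rule summable_norm[OF summ])
    also have "\<dots> \<le> C * norm x * 2"
      using suminf_le[OF bound summ sums_summable[OF geo]] sums_unique[OF geo] by simp
    finally show ?thesis
      by (simp add: mult_ac)
  qed
  then show ?thesis
    by (intro bounded_linear_intro[where K = "2 * C"]) (auto simp: add scale)
qed


section \<open>Bounded operators and complemented subspaces of a complex Banach space\<close>

lemma closed_csubspace_iff:
  "closed_csubspace M \<longleftrightarrow> 0 \<in> M \<and> (\<forall>x\<in>M. \<forall>y\<in>M. x + y \<in> M) \<and> (\<forall>c. \<forall>x\<in>M. c *\<^sub>C x \<in> M) \<and> closed M"
  by (auto simp: closed_csubspace_def complex_vector.subspace_def)

lemma closed_csubspace_0: "closed_csubspace M \<Longrightarrow> 0 \<in> M"
  by (simp add: closed_csubspace_iff)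

lemma closed_csubspace_add: "closed_csubspace M \<Longrightarrow> x \<in> M \<Longrightarrow> y \<in> M \<Longrightarrow> x + y \<in> M"
  by (simp add: closed_csubspace_iff)

lemma closed_csubspace_scaleC: "closed_csubspace M \<Longrightarrow> x \<in> M \<Longrightarrow> c *\<^sub>C x \<in> M"
  by (simp add: closed_csubspace_iff)

lemma closed_csubspace_diff: "closed_csubspace M \<Longrightarrow> x \<in> M \<Longrightarrow> y \<in> M \<Longrightarrow> x - y \<in> M"
  by (simp add: closed_csubspace_def complex_vector.subspace_diff)

lemma closed_csubspace_closed: "closed_csubspace M \<Longrightarrow> closed M"
  by (simp add: closed_csubspace_iff)

lemma closed_csubspace_null_space:
  assumes "bounded_clinear f"
  shows "closed_csubspace (null_space f)"
proof -
  interpret f: bounded_linear f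
    using assms by (simp add: bounded_clinear_def)
  have "closed (f -` {0})"
    by (intro closed_vimage continuous_intros f.continuous_on)
  moreover have "null_space f = f -` {0}"
    by (auto simp: null_space_def)
  ultimately show ?thesis
    using assms by (auto simp: closed_csubspace_iff null_space_def f.add f.zero bounded_clinear_def)
qed

lemma bounded_clinear_id: "bounded_clinear (\<lambda>x. x)"
  by (simp add: bounded_clinear_def)

lemma bounded_clinear_compose:
  assumes "bounded_clinear f" "bounded_clinear g"
  shows "bounded_clinear (\<lambda>x. f (g x))"
  using assms by (auto simp: bounded_clinear_def bounded_linear_compose)

lemma bounded_clinear_add:
  assumes "bounded_clinear f" "bounded_clinear g"
  shows "bounded_clinear (\<lambda>x. f x + g x)"
  using assms by (auto simp: bounded_clinear_def bounded_linear_add scaleC_add_right)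

lemma bounded_clinear_diff:
  assumes "bounded_clinear f" "bounded_clinear g"
  shows "bounded_clinear (\<lambda>x. f x - g x)"
  using assms
  by (auto simp: bounded_clinear_def bounded_linear_sub complex_vector.scale_right_diff_distrib)

lemma bounded_clinear_funpow:
  assumes "bounded_clinear f"
  shows "bounded_clinear (f ^^ n)"
  by (induction n) (simp_all add: id_def comp_def bounded_clinear_id bounded_clinear_compose[OF assms])

lemma bounded_clinear_simps:
  assumes "bounded_clinear f"
  shows "f (x + y) = f x + f y" "f (x - y) = f x - f y" "f (- x) = - f x" "f 0 = 0" "f (c *\<^sub>C x) = c *\<^sub>C f x"
  using assms by (auto simp: bounded_clinear_def linear_simps)

lemma bounded_clinear_tendsto:
  assumes "bounded_clinear f" "X \<longlonglongrightarrow> x"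
  shows "(\<lambda>n. f (X n)) \<longlonglongrightarrow> f x"
  using assms by (auto simp: bounded_clinear_def intro: bounded_linear.tendsto)

lemma bounded_clinear_onI:
  assumes "bounded_clinear f" "\<And>x. x \<in> M \<Longrightarrow> f x \<in> M"
  shows "bounded_clinear_on M f"
  using assms by (auto simp flip: bounded_clinear_on_UNIV simp: bounded_clinear_on_def)

lemma bounded_clinear_compose_on:
  assumes f: "bounded_clinear_on M f" and g: "bounded_clinear g" "\<And>x. g x \<in> M"
  shows "bounded_clinear (\<lambda>x. f (g x))"
proof -
  obtain K where K: "\<And>x. x \<in> M \<Longrightarrow> norm (f x) \<le> K * norm x"
    using f unfolding bounded_clinear_on_def by blast
  obtain B where B: "\<And>x. norm (g x) \<le> B * norm x"
    using g(1) unfolding bounded_clinear_on_UNIV[symmetric] bounded_clinear_on_def by blast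
  have "norm (f (g x)) \<le> (\<bar>K\<bar> * B) * norm x" for x
  proof -
    have "norm (f (g x)) \<le> K * norm (g x)"
      by (rule K[OF g(2)])
    also have "\<dots> \<le> \<bar>K\<bar> * norm (g x)"
      by (simp add: mult_right_mono)
    also have "\<dots> \<le> \<bar>K\<bar> * (B * norm x)"
      by (intro mult_left_mono B) simp
    finally show ?thesis
      by (simp add: mult.assoc)
  qed
  moreover have "f (g (x + y)) = f (g x) + f (g y)" "f (g (c *\<^sub>C x)) = c *\<^sub>C f (g x)" for c x y
    using f g(2) by (simp_all add: bounded_clinear_on_def bounded_clinear_simps[OF g(1)])
  ultimately show ?thesis
    unfolding bounded_clinear_on_UNIV[symmetric] bounded_clinear_on_def by blast
qed

lemma bounded_clinear_of_closed_relation: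
  fixes R :: "'a::complex_banach \<Rightarrow> 'a \<Rightarrow> bool"
  assumes total: "\<And>x. \<exists>y. R x y"
    and unique: "\<And>x y z. R x y \<Longrightarrow> R x z \<Longrightarrow> y = z"
    and add: "\<And>x y x' y'. R x y \<Longrightarrow> R x' y' \<Longrightarrow> R (x + x') (y + y')"
    and scale: "\<And>c x y. R x y \<Longrightarrow> R (c *\<^sub>C x) (c *\<^sub>C y)"
    and closed: "\<And>X Y x y. X \<longlonglongrightarrow> x \<Longrightarrow> Y \<longlonglongrightarrow> y \<Longrightarrow> (\<And>n. R (X n) (Y n)) \<Longrightarrow> R x y"
  obtains D where "bounded_clinear D" "\<And>x. R x (D x)"
proof -
  obtain D where D: "\<And>x. R x (D x)"
    using total by metis
  have D_scale: "D (c *\<^sub>C x) = c *\<^sub>C D x" for c x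
    by (rule unique[OF D scale[OF D]])
  have "linear D"
    by (intro linearI unique[OF D add[OF D D]]) (metis D_scale scaleC_of_real)
  then have "bounded_linear D"
    by (rule closed_graph_theorem) (metis D unique closed)
  with D D_scale show ?thesis
    by (intro that) (auto simp: bounded_clinear_def)
qed

lemma bounded_clinear_factor:
  assumes L: "closed_csubspace L" and F: "bounded_clinear F" and G: "bounded_clinear G"
    and inj: "\<And>l. l \<in> L \<Longrightarrow> F l = 0 \<Longrightarrow> l = 0"
    and range: "\<And>x. \<exists>l\<in>L. F l = G x"
  obtains D where "bounded_clinear D" "\<And>x. D x \<in> L" "\<And>x. F (D x) = G x"
proof (rule bounded_clinear_of_closed_relation[of "\<lambda>x y. y \<in> L \<and> F y = G x"])
  show "y = z" if "y \<in> L \<and> F y = G x" "z \<in> L \<and> F z = G x" for x y z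
    using inj[of "y - z"] that L by (auto simp: closed_csubspace_diff bounded_clinear_simps[OF F])
  show "y \<in> L \<and> F y = G x"
    if "X \<longlonglongrightarrow> x" "Y \<longlonglongrightarrow> y" "\<And>n. Y n \<in> L \<and> F (Y n) = G (X n)" for X Y x y
  proof
    show "y \<in> L"
      using that closed_csubspace_closed[OF L] closed_sequentially by blast
    show "F y = G x"
      using that bounded_clinear_tendsto[OF F that(2)] bounded_clinear_tendsto[OF G that(1)]
      by (simp add: LIMSEQ_unique)
  qed
qed (use L range that in \<open>auto simp: closed_csubspace_add closed_csubspace_scaleC
    bounded_clinear_simps[OF F] bounded_clinear_simps[OF G]\<close>)

lemma is_direct_sum_unique:
  assumes "is_direct_sum M N" "closed_csubspace M" "closed_csubspace N"
    and "x \<in> M" "x' \<in> M" "y \<in> N" "y' \<in> N" "x + y = x' + y'"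
  shows "x = x'"
proof -
  have "x - x' = y' - y"
    using assms(8) by (simp add: algebra_simps)
  then have "x - x' \<in> M \<inter> N"
    using assms closed_csubspace_diff by (metis IntI)
  then show ?thesis
    using assms(1) unfolding is_direct_sum_def by (metis right_minus_eq singletonD)
qed

lemma direct_sum_projection:
  assumes M: "closed_csubspace M" and N: "closed_csubspace N" and MN: "is_direct_sum M N"
  obtains p where "bounded_clinear p" "\<And>x. p x \<in> M" "\<And>x. x - p x \<in> N"
    "\<And>x. x \<in> M \<Longrightarrow> p x = x" "\<And>x. x \<in> N \<Longrightarrow> p x = 0"
proof (rule bounded_clinear_of_closed_relation[of "\<lambda>x y. y \<in> M \<and> x - y \<in> N"])
  show "\<exists>y. y \<in> M \<and> x - y \<in> N" for x
  proof -
    obtain m n where "m \<in> M" "n \<in> N" "x = m + n"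
      using MN unfolding is_direct_sum_def by blast
    then show ?thesis
      by (intro exI[of _ m]) simp
  qed
  show unique: "y = z" if "y \<in> M \<and> x - y \<in> N" "z \<in> M \<and> x - z \<in> N" for x y z
    using is_direct_sum_unique[OF MN M N, of y z "x - y" "x - z"] that by simp
  show "y + y' \<in> M \<and> x + x' - (y + y') \<in> N" if "y \<in> M \<and> x - y \<in> N" "y' \<in> M \<and> x' - y' \<in> N" for x y x' y'
    using that closed_csubspace_add[OF M] closed_csubspace_add[OF N, of "x - y" "x' - y'"]
    by (simp add: algebra_simps)
  show "c *\<^sub>C y \<in> M \<and> c *\<^sub>C x - c *\<^sub>C y \<in> N" if "y \<in> M \<and> x - y \<in> N" for c x y
    using that closed_csubspace_scaleC[OF M] closed_csubspace_scaleC[OF N, of "x - y" c]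
    by (simp add: complex_vector.scale_right_diff_distrib)
  show "y \<in> M \<and> x - y \<in> N"
    if "X \<longlonglongrightarrow> x" "Y \<longlonglongrightarrow> y" "\<And>n. Y n \<in> M \<and> X n - Y n \<in> N" for X Y x y
    using that closed_sequentially[OF closed_csubspace_closed[OF M], of Y y]
      closed_sequentially[OF closed_csubspace_closed[OF N], of "\<lambda>n. X n - Y n" "x - y"]
    by (auto intro: tendsto_diff)
  fix p
  assume p: "bounded_clinear p" "\<And>x. p x \<in> M \<and> x - p x \<in> N"
  show thesis
  proof (rule that)
    show "p x = x" if "x \<in> M" for x
      by (rule unique[OF p(2)]) (use that N in \<open>simp add: closed_csubspace_0\<close>)
    show "p x = 0" if "x \<in> N" for x
      by (rule unique[OF p(2)]) (use that M in \<open>simp add: closed_csubspace_0\<close>)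
  qed (use p in auto)
qed

lemma top_complemented_projection:
  assumes "top_complemented M"
  obtains p where "bounded_clinear p" "\<And>x. p x \<in> M" "\<And>x. x \<in> M \<Longrightarrow> p x = x"
proof -
  obtain N where "closed_csubspace M" "closed_csubspace N" "is_direct_sum M N"
    using assms unfolding top_complemented_def by blast
  then show thesis
    by (rule direct_sum_projection) (rule that)
qed

lemma idempotent_direct_sum:
  assumes E: "bounded_clinear E" and EE: "\<And>x. E (E x) = E x"
  shows "is_direct_sum (range E) (null_space E)" "closed_csubspace (range E)" "closed_csubspace (null_space E)"
proof -
  have range: "range E = null_space (\<lambda>x. x - E x)"
    using EE by (fastforce simp: null_space_def)
  show "closed_csubspace (range E)"
    unfolding range by (intro closed_csubspace_null_space bounded_clinear_diff bounded_clinear_id E)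
  show "closed_csubspace (null_space E)"
    by (intro closed_csubspace_null_space E)
  have zero: "E 0 = 0"
    by (rule bounded_clinear_simps(4)[OF E])
  have "range E \<inter> null_space E \<subseteq> {0}"
    by (auto simp: null_space_def EE)
  moreover have "0 \<in> range E \<inter> null_space E"
    using zero by (auto simp: null_space_def intro: range_eqI[of _ _ 0])
  moreover have "x \<in> {m + n |m n. m \<in> range E \<and> n \<in> null_space E}" for x
    by (intro CollectI exI[of _ "E x"] exI[of _ "x - E x"])
      (simp add: null_space_def bounded_clinear_simps[OF E] EE)
  ultimately show "is_direct_sum (range E) (null_space E)"
    unfolding is_direct_sum_def by blast
qed

lemma is_direct_sum_commute: "is_direct_sum M N \<longleftrightarrow> is_direct_sum N M"
proof -
  have "{m + n |m n. m \<in> M \<and> n \<in> N} = {m + n |m n. m \<in> N \<and> n \<in> M}"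
    by (metis (no_types, opaque_lifting) add.commute)
  then show ?thesis
    by (simp add: is_direct_sum_def Int_commute)
qed

lemma idempotent_top_complemented:
  assumes "bounded_clinear E" "\<And>x. E (E x) = E x"
  shows "top_complemented (range E)" "top_complemented (null_space E)"
proof -
  note E = idempotent_direct_sum[OF assms]
  show "top_complemented (range E)"
    unfolding top_complemented_def using E by blast
  show "top_complemented (null_space E)"
    unfolding top_complemented_def using E is_direct_sum_commute[of "range E"] by metis
qed

lemma top_complemented_closed: "top_complemented M \<Longrightarrow> closed M"
  by (simp add: top_complemented_def closed_csubspace_def)

lemma funpow_add_apply: "(f ^^ (m + n)) x = (f ^^ m) ((f ^^ n) x)"
  by (simp add: funpow_add)

lemma null_space_funpow_stable:
  assumes "null_space (T ^^ m) = null_space (T ^^ (m + 1))" "m \<le> n"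
  shows "null_space (T ^^ n) = null_space (T ^^ m)"
  using assms(2)
proof (induction n rule: dec_induct)
  case (step n)
  have "(T ^^ Suc n) x = 0 \<longleftrightarrow> (T ^^ n) x = 0" for x
  proof -
    have "(T ^^ Suc n) x = (T ^^ (m + 1)) ((T ^^ (n - m)) x)" "(T ^^ n) x = (T ^^ m) ((T ^^ (n - m)) x)"
      using step(1) by (simp_all only: funpow_add_apply[symmetric]) simp_all
    then show ?thesis
      using assms(1) by (auto simp: null_space_def set_eq_iff)
  qed
  then show ?case
    using step.IH by (simp add: null_space_def)
qed simp

lemma asc_eq_enat:
  assumes "null_space (T ^^ p) = null_space (T ^^ (p + 1))"
  obtains a where "asc T = enat a" "a \<le> p" "null_space (T ^^ a) = null_space (T ^^ (a + 1))"
proof -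
  define Q where "Q p \<longleftrightarrow> null_space (T ^^ p) = null_space (T ^^ (p + 1))" for p
  have p: "Q p"
    using assms by (simp add: Q_def)
  have "Inf {enat p | p. Q p} = enat (LEAST p. Q p)"
  proof (rule antisym)
    show "Inf {enat p | p. Q p} \<le> enat (LEAST p. Q p)"
      using LeastI[of Q, OF p] by (intro Inf_lower) blast
    show "enat (LEAST p. Q p) \<le> Inf {enat p | p. Q p}"
      by (intro Inf_greatest) (auto intro: Least_le)
  qed
  then show thesis
    using LeastI[of Q, OF p] Least_le[of Q, OF p] by (intro that) (auto simp: asc_def Q_def)
qed

lemma asc_null_space:
  assumes "asc T = enat a"
  shows "null_space (T ^^ a) = null_space (T ^^ (a + 1))"
proof -
  have "\<exists>p. null_space (T ^^ p) = null_space (T ^^ (p + 1))"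
  proof (rule ccontr)
    assume "\<not> ?thesis"
    then have "asc T = Inf {}"
      unfolding asc_def by (intro arg_cong[where f = Inf]) blast
    then show False
      using assms by (simp add: Inf_enat_def)
  qed
  then obtain b where "asc T = enat b" "null_space (T ^^ b) = null_space (T ^^ (b + 1))"
    using asc_eq_enat by blast
  then show ?thesis
    using assms by simp
qed

lemma idempotent_commute_funpow:
  assumes "T \<circ> P = P \<circ> T" "P \<circ> P = P"
  shows "((T \<circ> P) ^^ Suc k) x = (T ^^ Suc k) (P x)"
proof (induction k)
  case (Suc k)
  have "P ((T ^^ n) y) = (T ^^ n) (P y)" for n y
    using assms(1) by (induction n) (simp_all add: fun_eq_iff, metis)
  moreover have "((T \<circ> P) ^^ Suc (Suc k)) x = T (P (((T \<circ> P) ^^ Suc k) x))"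
    by simp
  ultimately show ?case
    using fun_cong[OF assms(2), of x] by (simp only: Suc) simp
qed simp

lemma bounded_clinear_sum:
  fixes n :: nat
  assumes "\<And>i. bounded_clinear (f i)"
  shows "bounded_clinear (\<lambda>x. \<Sum>i<n. f i x)"
  by (induction n) (use bounded_clinear_diff[OF bounded_clinear_id bounded_clinear_id]
      in \<open>simp_all add: bounded_clinear_add assms\<close>)

lemma neumann_nilpotent:
  assumes T: "bounded_clinear T"
  obtains R where "bounded_clinear R" "\<And>x. (T ^^ j) x = 0 \<Longrightarrow> R (T x + x) = x"
proof -
  define U where "U x = - T x" for x
  have U: "bounded_clinear U"
    using bounded_clinear_diff[OF bounded_clinear_diff[OF T T] T] by (simp add: U_def[abs_def])
  have pow: "(U ^^ i) x \<in> {(T ^^ i) x, - (T ^^ i) x}" for i x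
    by (induction i) (auto simp: U_def bounded_clinear_simps[OF T])
  show thesis
  proof (rule that)
    show "bounded_clinear (\<lambda>x. \<Sum>i<j. (U ^^ i) x)"
      by (intro bounded_clinear_sum bounded_clinear_funpow U)
    show "(\<Sum>i<j. (U ^^ i) (T x + x)) = x" if "(T ^^ j) x = 0" for x
    proof -
      have "T x + x = x - U x"
        by (simp add: U_def)
      then have "(\<Sum>i<j. (U ^^ i) (T x + x)) = (\<Sum>i<j. (U ^^ i) x - (U ^^ Suc i) x)"
        by (simp only: bounded_clinear_simps(2)[OF bounded_clinear_funpow[OF U]] funpow_Suc_right comp_apply)
      also have "\<dots> = x - (U ^^ j) x"
        by (subst sum_lessThan_telescope') simp
      also have "\<dots> = x"
        using pow[of j x] that by auto
      finally show ?thesis .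
    qed
  qed
qed

section \<open>Left Drazin inverses\<close>

locale left_Drazin =
  fixes T S :: "'a::complex_banach \<Rightarrow> 'a" and j :: nat
  assumes T: "bounded_clinear T" and S: "bounded_clinear S"
    and TST: "T (S (T x)) = S (T (T x))"
    and SST: "S (S (T x)) = S x"
    and S_pow: "S ((T ^^ (j + 1)) x) = (T ^^ j) x"

lemma left_Drazin_eq:
  assumes "bounded_clinear T"
  shows "left_Drazin T S j \<longleftrightarrow> bounded_clinear S \<and>
    T \<circ> S \<circ> T = S \<circ> T ^^ 2 \<and> S ^^ 2 \<circ> T = S \<and> S \<circ> T ^^ (j + 1) = T ^^ j"
  unfolding left_Drazin_def fun_eq_iff comp_apply numeral_2_eq_2 funpow.simps id_apply
  using assms by blast

context left_Drazin
begin

definition P where "P x = S (T x)"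

lemma bounded_clinear_P: "bounded_clinear P"
  unfolding P_def[abs_def] by (rule bounded_clinear_compose[OF S T])

lemma T_P: "T (P x) = P (T x)"
  by (simp add: P_def TST)

lemma P_P: "P (P x) = P x"
  by (simp add: P_def TST SST)

lemma S_P: "S (P x) = S x"
  by (simp add: P_def SST)

lemma pow_P: "(T ^^ k) (P x) = P ((T ^^ k) x)"
  by (induction k) (simp_all add: T_P)

lemma P_pow: "j \<le> k \<Longrightarrow> P ((T ^^ k) x) = (T ^^ k) x"
  using S_pow[of "(T ^^ (k - j)) x"] funpow_add_apply[of j "k - j" T x] by (simp add: P_def)

lemma S_pow_T_pow: "(S ^^ Suc k) ((T ^^ Suc k) x) = P x"
proof (induction k arbitrary: x)
  case (Suc k)
  have "(S ^^ Suc (Suc k)) ((T ^^ Suc (Suc k)) x) = S ((S ^^ Suc k) ((T ^^ Suc k) (T x)))"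
    by (simp add: funpow_swap1)
  then show ?case
    unfolding Suc by (simp add: S_P) (simp add: P_def)
qed (simp add: P_def)

lemma pow_eq_0_iff:
  assumes "j \<le> k"
  shows "(T ^^ k) x = 0 \<longleftrightarrow> P x = 0"
proof
  assume "(T ^^ k) x = 0"
  then show "P x = 0"
    using S_pow_T_pow[of "k - 1" x] bounded_clinear_simps(4)[OF bounded_clinear_funpow[OF S], of k]
    by (cases k) (simp_all add: bounded_clinear_simps[OF bounded_clinear_P])
next
  assume "P x = 0"
  then show "(T ^^ k) x = 0"
    using P_pow[OF assms, of x] pow_P[of k x]
    by (simp add: bounded_clinear_simps[OF bounded_clinear_funpow[OF T]])
qed

lemma null_space_pow: "j \<le> k \<Longrightarrow> null_space (T ^^ k) = null_space P"
  by (simp add: null_space_def pow_eq_0_iff)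

lemma pow_S_pow_pow:
  assumes "j \<le> k"
  shows "(T ^^ k) ((S ^^ k) ((T ^^ k) x)) = (T ^^ k) x"
  using P_pow[OF assms, of x] S_pow_T_pow[of "k - 1" x] pow_P[of k x] by (cases k) simp_all

lemma top_complemented_null_space_pow: "j \<le> k \<Longrightarrow> top_complemented (null_space (T ^^ k))"
  using idempotent_top_complemented(2)[OF bounded_clinear_P P_P] by (simp add: null_space_pow)

lemma top_complemented_range_pow:
  assumes "j \<le> k"
  shows "top_complemented (range (T ^^ k))"
proof -
  have "top_complemented (range (\<lambda>x. (T ^^ k) ((S ^^ k) x)))"
    by (intro idempotent_top_complemented bounded_clinear_compose[of "T ^^ k" "S ^^ k"]
        bounded_clinear_funpow T S)
      (simp add: pow_S_pow_pow assms)
  also have "range (\<lambda>x. (T ^^ k) ((S ^^ k) x)) = range (T ^^ k)"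
    using pow_S_pow_pow[OF assms] by (auto simp: image_iff) metis
  finally show ?thesis .
qed

lemma reduce_range_P: "reduce (range P) (null_space (T ^^ j)) T"
  unfolding reduce_def null_space_pow[OF order_refl]
proof (intro conjI idempotent_direct_sum bounded_clinear_P P_P)
  show "T ` range P \<subseteq> range P"
    by (auto simp: T_P)
  show "T ` null_space P \<subseteq> null_space P"
    by (auto simp: null_space_def bounded_clinear_simps[OF T] simp flip: T_P)
qed

lemma left_invertible_on_range_P: "left_invertible_on (range P) T"
proof -
  have "bounded_clinear_on (range P) T"
    by (rule bounded_clinear_onI[OF T]) (auto simp: T_P)
  moreover have "bounded_clinear_on (range P) (\<lambda>x. P (S x))"
    by (rule bounded_clinear_onI[OF bounded_clinear_compose[OF bounded_clinear_P S]]) auto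
  moreover have "P (S (T x)) = x" if "x \<in> range P" for x
    using that P_P by (auto simp flip: P_def)
  ultimately show ?thesis
    unfolding left_invertible_on_def by blast
qed

lemma nilpotent_on_null_space: "nilpotent_on (null_space (T ^^ j)) T"
proof -
  have "bounded_clinear_on (null_space (T ^^ j)) T"
    using reduce_range_P by (intro bounded_clinear_onI[OF T]) (auto simp: reduce_def)
  then show ?thesis
    using bounded_clinear_simps(4)[OF T] unfolding nilpotent_on_def
    by (intro conjI exI[of _ "Suc j"]) (auto simp: null_space_def)
qed

lemma left_invertible_on_range_pow: "left_invertible_on (range (T ^^ j)) T"
proof -
  have "bounded_clinear_on (range (T ^^ j)) T"
    by (rule bounded_clinear_onI[OF T]) (auto simp: funpow_swap1)
  moreover have "bounded_clinear_on (range (T ^^ j)) (\<lambda>x. (T ^^ j) ((S ^^ j) (S x)))"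
    by (rule bounded_clinear_onI[OF bounded_clinear_compose[OF bounded_clinear_funpow[OF T]
          bounded_clinear_compose[OF bounded_clinear_funpow[OF S] S]]]) auto
  moreover have "(T ^^ j) ((S ^^ j) (S (T x))) = x" if "x \<in> range (T ^^ j)" for x
    using that P_pow[OF order_refl] pow_S_pow_pow[OF order_refl] by (auto simp flip: P_def)
  ultimately show ?thesis
    unfolding left_invertible_on_def by blast
qed

lemma left_Drazin_ascent:
  obtains a where "asc T = enat a" "left_Drazin T S a"
proof -
  have "null_space (T ^^ j) = null_space (T ^^ (j + 1))"
    by (simp only: null_space_pow[of j] null_space_pow[of "j + 1"] order_refl le_add1)
  then obtain a where a: "asc T = enat a" "a \<le> j" "null_space (T ^^ a) = null_space (T ^^ (a + 1))"
    by (rule asc_eq_enat)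
  have "S ((T ^^ (a + 1)) x) = (T ^^ a) x" for x
  proof -
    have "x - P x \<in> null_space (T ^^ j)"
      by (simp add: null_space_def pow_eq_0_iff bounded_clinear_simps[OF bounded_clinear_P] P_P)
    then have "(T ^^ a) (x - P x) = 0"
      unfolding null_space_funpow_stable[OF a(3,2)] by (simp add: null_space_def)
    then show ?thesis
      using pow_P[of a x]
      by (simp add: bounded_clinear_simps[OF bounded_clinear_funpow[OF T]] P_def)
  qed
  with a(1) show ?thesis
    by (intro that[of a]) (unfold_locales, use T S TST SST in auto)
qed

lemma projection_complement:
  "\<exists>Q. projection Q \<and> T \<circ> Q = Q \<circ> T \<and>
    left_invertible_on UNIV (\<lambda>x. T x + Q x) \<and> nilpotent_on UNIV (T \<circ> Q)"
proof (intro exI conjI)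
  define Q where "Q x = x - P x" for x
  have Q: "bounded_clinear Q"
    unfolding Q_def[abs_def] by (intro bounded_clinear_diff bounded_clinear_id bounded_clinear_P)
  have QQ: "Q \<circ> Q = Q"
    by (auto simp: Q_def bounded_clinear_simps[OF bounded_clinear_P] P_P)
  then show "projection Q"
    by (simp add: projection_def Q)
  show TQ: "T \<circ> Q = Q \<circ> T"
    by (auto simp: Q_def bounded_clinear_simps[OF T] T_P)
  have pow_Q: "(T ^^ j) (Q x) = 0" for x
    by (simp add: pow_eq_0_iff Q_def bounded_clinear_simps[OF bounded_clinear_P] P_P)
  have "((T \<circ> Q) ^^ Suc j) x = 0" for x
    unfolding idempotent_commute_funpow[OF TQ QQ] by (simp add: pow_Q bounded_clinear_simps[OF T])
  moreover have "bounded_clinear (T \<circ> Q)"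
    using bounded_clinear_compose[OF T Q] by (simp add: comp_def)
  ultimately show "nilpotent_on UNIV (T \<circ> Q)"
    unfolding nilpotent_on_def bounded_clinear_on_UNIV by (intro conjI exI[of _ "Suc j"]) auto
  obtain R where R: "bounded_clinear R" "\<And>x. (T ^^ j) x = 0 \<Longrightarrow> R (T x + x) = x"
    using neumann_nilpotent[OF T] by metis
  have "S (T x + Q x) + R (Q (T x + Q x)) = x" for x
  proof -
    have "S (Q x) = 0"
      by (simp add: Q_def bounded_clinear_simps[OF S] S_P)
    moreover have "Q (T x + Q x) = T (Q x) + Q x"
      using TQ QQ by (simp add: bounded_clinear_simps[OF Q] fun_eq_iff)
    ultimately show ?thesis
      by (simp add: bounded_clinear_simps[OF S] R(2)[OF pow_Q]) (simp add: Q_def P_def)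
  qed
  then show "left_invertible_on UNIV (\<lambda>x. T x + Q x)"
    unfolding left_invertible_on_def bounded_clinear_on_UNIV
    by (intro conjI exI[of _ "\<lambda>x. S x + R (Q x)"] bounded_clinear_add
        bounded_clinear_compose[OF R(1) Q] T S Q) auto
qed

end

text \<open>The hypotheses make \<open>W \<circ> T\<close> a projection along the null space of \<open>T ^^ j\<close>. The operators
  \<open>P i\<close> in the proof iterate the equation \<open>P = W T - W T T W + T P W\<close>, each of whose fixed points
  that absorb \<open>W T\<close> on the right commutes with \<open>T\<close>.\<close>

lemma left_Drazin_of_inner:
  assumes T: "bounded_clinear T" and W: "bounded_clinear W"
    and WWT: "\<And>x. W (W (T x)) = W x"
    and TWT: "\<And>x. (T ^^ j) (W (T x)) = (T ^^ j) x"
    and ker: "\<And>x. (T ^^ j) x = 0 \<Longrightarrow> W (T x) = 0"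
  obtains S where "left_Drazin T S j"
proof -
  define P where "P = rec_nat (\<lambda>x. W (T x)) (\<lambda>_ p x. W (T x) - W (T (T (W x))) + T (p (W x)))"
  have P_0: "P 0 x = W (T x)" and P_Suc: "P (Suc i) x = W (T x) - W (T (T (W x))) + T (P i (W x))" for i x
    by (simp_all add: P_def)
  note lin = bounded_clinear_simps[OF T] bounded_clinear_simps[OF W]
    bounded_clinear_simps[OF bounded_clinear_funpow[OF T]]
  have P: "bounded_clinear (P i)" for i
  proof (induction i)
    case 0
    then show ?case
      unfolding P_0[abs_def] by (rule bounded_clinear_compose[OF W T])
  next
    case (Suc i)
    show ?case
      unfolding P_Suc[abs_def]
      by (intro bounded_clinear_add bounded_clinear_diff bounded_clinear_compose[OF W]
          bounded_clinear_compose[OF T] bounded_clinear_compose[OF Suc] T W)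
  qed
  have cong: "W (T x) = W (T y)" if "(T ^^ j) x = (T ^^ j) y" for x y
    using ker[of "x - y"] that by (simp add: lin)
  have pow_P: "(T ^^ j) (P i x) = (T ^^ j) x" for i x
  proof (induction i arbitrary: x)
    case (Suc i)
    then show ?case
      by (simp add: P_Suc lin TWT flip: funpow_swap1)
  qed (simp add: P_0 TWT)
  have P_WT: "P i (W (T x)) = P i x" for i x
    using cong[OF TWT] by (cases i) (simp_all add: P_0 P_Suc WWT)
  have P_T: "P (Suc i) (T x) = T (P i x)" for i x
  proof -
    have "W (T (T (W (T x)))) = W (T (T x))"
      by (rule cong) (simp add: TWT flip: funpow_swap1)
    then show ?thesis
      by (simp add: P_Suc P_WT)
  qed
  have "(T ^^ k) (P (Suc i) x) = (T ^^ k) (P i x)" if "k + i = j" for k i x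
    using that
  proof (induction i arbitrary: k x)
    case 0
    then show ?case
      using pow_P by simp
  next
    case (Suc i)
    then have "(T ^^ k) (T (P (Suc i) (W x))) = (T ^^ k) (T (P i (W x)))"
      using Suc.IH[of "Suc k" "W x"] by (simp add: funpow_swap1)
    then show ?case
      unfolding P_Suc[of "Suc i"] P_Suc[of i x] lin by simp
  qed
  from this[of 0 j] have stable: "P (Suc j) x = P j x" for x
    by simp
  have P_comm: "P j (T x) = T (P j x)" for x
    using P_T[of j x] by (simp add: stable)
  have P_comm_pow: "P j ((T ^^ k) x) = (T ^^ k) (P j x)" for k x
    by (induction k) (simp_all add: P_comm)
  have W_P: "W (P j x) = W x" for x
    using WWT[of "P j x"] WWT[of x] cong[OF pow_P[of j x]] by simp
  show thesis
  proof (rule that)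
    show "left_Drazin T (\<lambda>x. P j (W x)) j"
      by unfold_locales
        (simp_all add: bounded_clinear_compose[OF P W] T P_WT P_comm P_comm_pow W_P pow_P)
  qed
qed

lemma complement_null_space:
  assumes F: "bounded_clinear F" and null: "top_complemented (null_space F)"
  obtains L where "closed_csubspace L" "\<And>x y. x \<in> L \<Longrightarrow> y \<in> L \<Longrightarrow> F x = F y \<Longrightarrow> x = y"
    "\<And>x. \<exists>l\<in>L. F l = F x"
proof -
  note lin = bounded_clinear_simps[OF F]
  obtain L where L: "closed_csubspace L" "is_direct_sum (null_space F) L"
    using null unfolding top_complemented_def by blast
  have "\<exists>l\<in>L. F l = F x" for x
  proof -
    obtain n l where "n \<in> null_space F" "l \<in> L" "x = n + l"
      using L(2) unfolding is_direct_sum_def by blast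
    then show ?thesis
      by (auto simp: null_space_def lin)
  qed
  moreover have "x = y" if "x \<in> L" "y \<in> L" "F x = F y" for x y
  proof -
    have "x - y \<in> null_space F \<inter> L"
      using that L(1) by (simp add: null_space_def lin closed_csubspace_diff)
    then show ?thesis
      using L(2) unfolding is_direct_sum_def by simp
  qed
  ultimately show thesis
    using L(1) that by blast
qed

lemma left_Drazin_of_ascent:
  assumes T: "bounded_clinear T" and asc: "asc T = enat j"
    and null: "top_complemented (null_space (T ^^ j))" and range: "top_complemented (range (T ^^ (j + 1)))"
  obtains S where "left_Drazin T S j"
proof -
  note lin = bounded_clinear_simps[OF bounded_clinear_funpow[OF T]]
  obtain L where L: "closed_csubspace L"
    "\<And>x y. x \<in> L \<Longrightarrow> y \<in> L \<Longrightarrow> (T ^^ j) x = (T ^^ j) y \<Longrightarrow> x = y" "\<And>x. \<exists>l\<in>L. (T ^^ j) l = (T ^^ j) x"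
    using complement_null_space[OF bounded_clinear_funpow[OF T] null] by metis
  obtain Q where Q: "bounded_clinear Q" "\<And>x. Q x \<in> range (T ^^ (j + 1))"
    "\<And>x. x \<in> range (T ^^ (j + 1)) \<Longrightarrow> Q x = x"
    by (rule top_complemented_projection[OF range]) (rule that)
  have Q_pow: "Q ((T ^^ (j + 1)) x) = (T ^^ (j + 1)) x" for x
    by (rule Q(3)) (rule rangeI)
  have pow_eq: "(T ^^ j) x = (T ^^ j) y \<longleftrightarrow> (T ^^ (j + 1)) x = (T ^^ (j + 1)) y" for x y
  proof -
    have "(T ^^ j) (x - y) = 0 \<longleftrightarrow> (T ^^ (j + 1)) (x - y) = 0"
      using asc_null_space[OF asc] unfolding null_space_def by blast
    then show ?thesis
      by (simp only: lin right_minus_eq)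
  qed
  obtain D where D: "bounded_clinear D" "\<And>x. D x \<in> L" "\<And>x. (T ^^ (j + 1)) (D x) = Q x"
  proof (rule bounded_clinear_factor[OF L(1) bounded_clinear_funpow[OF T, of "j + 1"] Q(1)])
    show "l = 0" if "l \<in> L" "(T ^^ (j + 1)) l = 0" for l
    proof (rule L(2)[OF that(1) closed_csubspace_0[OF L(1)]])
      show "(T ^^ j) l = (T ^^ j) 0"
        unfolding pow_eq using that(2) by (simp only: lin)
    qed
    show "\<exists>l\<in>L. (T ^^ (j + 1)) l = Q x" for x
      using Q(2)[of x] L(3) unfolding pow_eq by (metis imageE)
  qed (rule that)
  define W where "W x = D ((T ^^ j) x)" for x
  have W: "bounded_clinear W"
    unfolding W_def[abs_def] by (rule bounded_clinear_compose[OF D(1) bounded_clinear_funpow[OF T]])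
  have TWT: "(T ^^ j) (W (T x)) = (T ^^ j) x" for x
  proof -
    have "(T ^^ j) (T x) = (T ^^ (j + 1)) x"
      by (simp add: funpow_swap1)
    then show ?thesis
      unfolding pow_eq W_def D(3) by (simp only: Q_pow)
  qed
  have "W (W (T x)) = W x" for x
    unfolding W_def[of "W (T x)"] TWT by (simp add: W_def)
  moreover have "W (T x) = 0" if "(T ^^ j) x = 0" for x
    using that by (simp add: W_def bounded_clinear_simps[OF D(1)] bounded_clinear_simps[OF T]
        flip: funpow_swap1)
  ultimately show thesis
    by (rule left_Drazin_of_inner[OF T W _ TWT _ that])
qed

lemma left_Drazin_of_range_pow:
  assumes T: "bounded_clinear T"
    and null: "top_complemented (null_space (T ^^ j))" and inv: "left_invertible_on (range (T ^^ j)) T"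
  obtains S where "left_Drazin T S j"
proof -
  note powT = bounded_clinear_funpow[OF T, of j]
  note lin = bounded_clinear_simps[OF powT]
  obtain L where L: "closed_csubspace L"
    "\<And>x y. x \<in> L \<Longrightarrow> y \<in> L \<Longrightarrow> (T ^^ j) x = (T ^^ j) y \<Longrightarrow> x = y" "\<And>x. \<exists>l\<in>L. (T ^^ j) l = (T ^^ j) x"
    using complement_null_space[OF powT null] by metis
  obtain A where A: "bounded_clinear_on (range (T ^^ j)) A" "\<And>x. A (T ((T ^^ j) x)) = (T ^^ j) x"
    using inv unfolding left_invertible_on_def by blast
  have A_range: "A ((T ^^ j) x) \<in> range (T ^^ j)" for x
    using A(1) by (auto simp: bounded_clinear_on_def)
  have A_pow: "bounded_clinear (\<lambda>x. A ((T ^^ j) x))"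
    by (rule bounded_clinear_compose_on[OF A(1) powT]) simp
  obtain W where W: "bounded_clinear W" "\<And>x. W x \<in> L" "\<And>x. (T ^^ j) (W x) = A ((T ^^ j) x)"
  proof (rule bounded_clinear_factor[OF L(1) powT A_pow])
    show "l = 0" if "l \<in> L" "(T ^^ j) l = 0" for l
      by (rule L(2)[OF that(1) closed_csubspace_0[OF L(1)]]) (simp add: lin that)
    show "\<exists>l\<in>L. (T ^^ j) l = A ((T ^^ j) x)" for x
      using A_range[of x] L(3) by (metis imageE)
  qed (rule that)
  have TWT: "(T ^^ j) (W (T x)) = (T ^^ j) x" for x
    using A(2)[of x] by (simp add: W(3) funpow_swap1)
  have "W (W (T x)) = W x" for x
    by (rule L(2)[OF W(2) W(2)]) (simp only: W(3)[of "W (T x)"] W(3)[of x] TWT)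
  moreover have "W (T x) = 0" if "(T ^^ j) x = 0" for x
    by (rule L(2)[OF W(2) closed_csubspace_0[OF L(1)]]) (simp add: TWT lin that)
  ultimately show thesis
    by (rule left_Drazin_of_inner[OF T W(1) _ TWT _ that])
qed

lemma left_Drazin_of_reduce:
  assumes T: "bounded_clinear T" and red: "reduce M N T"
    and inv: "left_invertible_on M T" and nil: "nilpotent_on N T"
  obtains S j where "left_Drazin T S j"
proof -
  obtain p where p: "bounded_clinear p" "\<And>x. p x \<in> M" "\<And>x. x - p x \<in> N"
    "\<And>x. x \<in> M \<Longrightarrow> p x = x" "\<And>x. x \<in> N \<Longrightarrow> p x = 0"
    using red direct_sum_projection unfolding reduce_def by metis
  obtain B where B: "bounded_clinear_on M B" "\<And>x. x \<in> M \<Longrightarrow> B (T x) = x"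
    using inv unfolding left_invertible_on_def by blast
  obtain j where j: "\<And>x. x \<in> N \<Longrightarrow> (T ^^ j) x = 0"
    using nil unfolding nilpotent_on_def by blast
  have inv_M: "T x \<in> M" "B x \<in> M" if "x \<in> M" for x
    using that red B(1) by (auto simp: reduce_def bounded_clinear_on_def)
  have p_T: "p (T x) = T (p x)" for x
  proof -
    have "p (T (p x) + T (x - p x)) = T (p x)"
      using red p(2)[of x] p(3)[of x]
      by (subst bounded_clinear_simps[OF p(1)]) (auto simp: reduce_def p(4,5) image_subset_iff)
    then show ?thesis
      by (simp flip: bounded_clinear_simps(1)[OF T])
  qed
  have p_T_pow: "p ((T ^^ k) x) = (T ^^ k) (p x)" for k x
    by (induction k) (simp_all add: p_T)
  have "bounded_clinear (\<lambda>x. B (p x))"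
    by (rule bounded_clinear_compose_on[OF B(1) p(1,2)])
  moreover have pow_p: "(T ^^ j) (p x) = (T ^^ j) x" for x
    using j[OF p(3)[of x]] by (simp add: bounded_clinear_simps[OF bounded_clinear_funpow[OF T]])
  moreover have "(T ^^ j) x \<in> M" for x
  proof -
    have "(T ^^ k) (p x) \<in> M" for k
      by (induction k) (simp_all add: inv_M p)
    then show ?thesis
      by (metis pow_p)
  qed
  ultimately have "left_Drazin T (\<lambda>x. B (p x)) j"
    by unfold_locales (simp_all add: T p p_T p_T_pow B inv_M)
  then show thesis
    by (rule that)
qed

lemma left_Drazin_of_projection:
  assumes T: "bounded_clinear T" and Q: "projection Q" "T \<circ> Q = Q \<circ> T"
    and inv: "left_invertible_on UNIV (\<lambda>x. T x + Q x)" and nil: "nilpotent_on UNIV (T \<circ> Q)"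
  obtains S j where "left_Drazin T S j"
proof -
  define P where "P x = x - Q x" for x
  have Q': "bounded_clinear Q" "Q \<circ> Q = Q"
    using Q(1) by (simp_all add: projection_def)
  have P: "bounded_clinear P"
    unfolding P_def[abs_def] by (intro bounded_clinear_diff bounded_clinear_id Q')
  have QP: "Q (P x) = 0" for x
    using Q'(2) by (simp add: P_def bounded_clinear_simps[OF Q'(1)] fun_eq_iff)
  have PP: "P (P x) = P x" for x
    unfolding P_def[of "P x"] by (simp add: QP)
  have P_T: "P (T x) = T (P x)" for x
    using Q(2) by (simp add: P_def bounded_clinear_simps[OF T] fun_eq_iff)
  have P_T_pow: "P ((T ^^ k) x) = (T ^^ k) (P x)" for k x
    by (induction k) (simp_all add: P_T)
  obtain C where C: "bounded_clinear C" "\<And>x. C (T x + Q x) = x"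
    using inv unfolding left_invertible_on_def bounded_clinear_on_UNIV by blast
  have CTP: "C (T (P x)) = P x" for x
    using C(2)[of "P x"] by (simp add: QP)
  obtain j where j: "j \<ge> 1" "\<And>x. ((T \<circ> Q) ^^ j) x = 0"
    using nil unfolding nilpotent_on_def by blast
  have "(T ^^ j) (Q x) = 0" for x
    using j idempotent_commute_funpow[OF Q(2) Q'(2), of "j - 1" x] by simp
  then have pow_P: "(T ^^ j) (P x) = (T ^^ j) x" for x
    by (simp add: P_def bounded_clinear_simps[OF bounded_clinear_funpow[OF T]])
  have "C (T ((T ^^ j) x)) = (T ^^ j) x" for x
    using CTP[of "(T ^^ j) x"] by (simp add: P_T_pow pow_P)
  moreover have "C (T (T (P x))) = T (P x)" for x
    using CTP[of "T x"] by (simp add: P_T)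
  ultimately have "left_Drazin T (\<lambda>x. P (C (P x))) j"
    by unfold_locales
      (simp_all add: bounded_clinear_compose[OF P bounded_clinear_compose[OF C(1) P]] T
        P_T P_T_pow PP CTP pow_P)
  then show thesis
    by (rule that)
qed

theorem theorem3p8:
  fixes T :: "'a::complex_banach \<Rightarrow> 'a"
  assumes "bounded_clinear T"
  shows "tfae
    [\<exists>S\<^sub>1 (j::nat). bounded_clinear S\<^sub>1 \<and>
        T \<circ> S\<^sub>1 \<circ> T = S\<^sub>1 \<circ> T ^^ 2 \<and> S\<^sub>1 ^^ 2 \<circ> T = S\<^sub>1 \<and> S\<^sub>1 \<circ> T ^^ (j + 1) = T ^^ j,
     \<exists>P. projection P \<and> T \<circ> P = P \<circ> T \<and>
        left_invertible_on UNIV (\<lambda>x. T x + P x) \<and> nilpotent_on UNIV (T \<circ> P),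
     \<exists>j::nat. asc T = enat j \<and>
        top_complemented (null_space (T ^^ j)) \<and> top_complemented (range (T ^^ (j + 1))),
     \<exists>(j::nat) M. reduce M (null_space (T ^^ j)) T \<and>
        left_invertible_on M T \<and> nilpotent_on (null_space (T ^^ j)) T,
     \<exists>M N. reduce M N T \<and> left_invertible_on M T \<and> nilpotent_on N T,
     \<exists>j::nat. top_complemented (null_space (T ^^ j)) \<and> closed (range (T ^^ j)) \<and>
        left_invertible_on (range (T ^^ j)) T]"
proof -
  let "tfae [?i, ?ii, ?iii, ?iv, ?v, ?vi]" = ?thesis
  let ?D = "\<exists>S j. left_Drazin T S j"
  have i: "?i \<longleftrightarrow> ?D"
    by (simp only: left_Drazin_eq[OF assms])
  have ii: "?ii \<longleftrightarrow> ?D"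
    using left_Drazin.projection_complement left_Drazin_of_projection[OF assms] by metis
  have iii: "?iii \<longleftrightarrow> ?D"
  proof
    assume ?D
    then obtain S j where "left_Drazin T S j"
      by blast
    then obtain a where a: "asc T = enat a" "left_Drazin T S a"
      by (rule left_Drazin.left_Drazin_ascent)
    then show ?iii
      using left_Drazin.top_complemented_null_space_pow[OF a(2), of a]
        left_Drazin.top_complemented_range_pow[OF a(2), of "a + 1"] by auto
  qed (use left_Drazin_of_ascent[OF assms] in metis)
  have D_iv: "?D \<Longrightarrow> ?iv"
    using left_Drazin.reduce_range_P left_Drazin.left_invertible_on_range_P
      left_Drazin.nilpotent_on_null_space by blast
  have iv_v: "?iv \<Longrightarrow> ?v"
    by blast
  have v_D: "?v \<Longrightarrow> ?D"
    using left_Drazin_of_reduce[OF assms] by blast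
  have iv: "?iv \<longleftrightarrow> ?D"
    by (rule iffI[OF v_D[OF iv_v] D_iv])
  have v: "?v \<longleftrightarrow> ?D"
    by (rule iffI[OF v_D iv_v[OF D_iv]])
  have vi: "?vi \<longleftrightarrow> ?D"
  proof
    assume ?D
    then obtain S j where "left_Drazin T S j"
      by blast
    then show ?vi
      using left_Drazin.top_complemented_null_space_pow left_Drazin.left_invertible_on_range_pow
        left_Drazin.top_complemented_range_pow top_complemented_closed by (metis order_refl)
  qed (use left_Drazin_of_range_pow[OF assms] in metis)
  show ?thesis
    unfolding i ii iii iv v vi by (simp add: tfae_def)
qed

end
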